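(* Let $(S,\mathcal{F},Q)$ be a probability space with expectation $\mathbf{E}$, let $p,q>0$ satisfy $\frac1p+\frac1q=1$, and let $X\in L^p(S,\mathcal{F},Q)$ and $Y\in L^q(S,\mathcal{F},Q)$ be real-valued random variables with $\|X\|_p\neq 0$ and $\|Y\|_q\neq 0$. Put $U=|X|^{p/2}$ and $V=|Y|^{q/2}$ (both in $L^2$). Then $$\mathbf{E}(|XY|)\leq \|X\|_p\|Y\|_q\left(\frac{1}{p^{2}}+\frac{1}{q^{2}}+\frac{2}{pq}\sqrt{1-\left(\frac{\sigma_V\,\mathbf{E}|X|^{p/2}-\sigma_U\,\mathbf{E}|Y|^{q/2}}{\|X\|_p^{p/2}\,\|Y\|_q^{q/2}}\right)^2}\;\right)\leq \|X\|_p\|Y\|_q .$$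
   Context: For $r>0$ and a random variable $Z$, $\|Z\|_r=(\mathbf{E}|Z|^r)^{1/r}$. For a random variable $Z\in L^2$, $\sigma_Z=\sqrt{\mathbf{E}(Z^2)-(\mathbf{E}Z)^2}\ge 0$ denotes its standard deviation. *)

theory Defs
  imports "HOL-Probability.Probability"
begin

(* Random variables are functions, not classes modulo almost sure equality. *)
definition Lp_space :: "'a measure \<Rightarrow> real \<Rightarrow> ('a \<Rightarrow> real) set" where
  "Lp_space M r = {Z \<in> borel_measurable M. integrable M (\<lambda>x. \<bar>Z x\<bar> powr r)}"

(* The Bochner integral of a non-integrable function is 0, so Lp_norm and std_dev
   have their usual meaning only for Z in Lp_space M r and in Lp_space M 2 (over a
   probability space), respectively. *)
definition Lp_norm :: "'a measure \<Rightarrow> real \<Rightarrow> ('a \<Rightarrow> real) \<Rightarrow> real" where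
  "Lp_norm M r Z = (\<integral>x. \<bar>Z x\<bar> powr r \<partial>M) powr (1 / r)"

definition std_dev :: "'a measure \<Rightarrow> ('a \<Rightarrow> real) \<Rightarrow> real" where
  "std_dev M Z = sqrt ((\<integral>x. (Z x)\<^sup>2 \<partial>M) - (\<integral>x. Z x \<partial>M)\<^sup>2)"

end

theory Submission
  imports Defs
begin

text \<open>
  The classical proof of Hoelder's inequality normalises \<open>X\<close> and \<open>Y\<close> and integrates Young's
  inequality \<open>x y \<le> x\<^sup>p/p + y\<^sup>q/q\<close>.  Here Young's inequality is applied to \<open>sqrt x\<close> and \<open>sqrt y\<close> and
  then squared (\<open>Young_half_powers\<close>), so that after integration the cross term of the square
  survives.  With \<open>N = \<parallel>X\<parallel>\<^sub>p powr (p/2)\<close> and \<open>K = \<parallel>Y\<parallel>\<^sub>q powr (q/2)\<close>, the \<open>L\<^sup>2\<close> norms of \<open>U\<close> and \<open>V\<close>,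
  this yields
  \<open>E |X Y| \<le> \<parallel>X\<parallel>\<^sub>p \<parallel>Y\<parallel>\<^sub>q (1/p\<^sup>2 + 1/q\<^sup>2 + 2/(p q) * E (U V) / (N K))\<close>.

  It remains to bound the correlation \<open>E (U V) / (N K)\<close>.  By Cauchy--Schwarz for the centred
  variables (\<open>covariance_le_std_dev_mult\<close>), \<open>E (U V) \<le> E U E V + \<sigma>\<^sub>U \<sigma>\<^sub>V\<close>.  The plane vectors
  \<open>(E U, \<sigma>\<^sub>U)\<close> and \<open>(E V, \<sigma>\<^sub>V)\<close> have lengths \<open>N\<close> and \<open>K\<close> and lie in the first quadrant.  The right-hand
  side is their inner product, hence \<open>N K\<close> times the cosine of the angle between them, while
  \<open>\<sigma>\<^sub>V E U - \<sigma>\<^sub>U E V\<close> is their determinant, \<open>N K\<close> times its sine.  The square root in the theorem is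
  exactly this cosine (\<open>sqrt_one_minus_det_sq_eq_inner\<close>).  Bounding the cosine by \<open>1\<close> turns the
  parenthesis into \<open>(1/p + 1/q)\<^sup>2 = 1\<close>, the second inequality.
\<close>

text \<open>
  Lagrange's identity in the plane: for nonzero vectors at an angle of at most a right angle, the
  cosine is \<open>sqrt (1 - sin\<^sup>2)\<close>.
\<close>

lemma sqrt_one_minus_det_sq_eq_inner:
  fixes m s n t N K :: real
  assumes "N > 0" "K > 0" "m\<^sup>2 + s\<^sup>2 = N\<^sup>2" "n\<^sup>2 + t\<^sup>2 = K\<^sup>2" "m * n + s * t \<ge> 0"
  shows "sqrt (1 - ((t * m - s * n) / (N * K))\<^sup>2) = (m * n + s * t) / (N * K)"
proof (rule real_sqrt_unique)
  have "(m * n + s * t)\<^sup>2 + (t * m - s * n)\<^sup>2 = (m\<^sup>2 + s\<^sup>2) * (n\<^sup>2 + t\<^sup>2)"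
    by (simp add: power2_eq_square algebra_simps)
  also have "\<dots> = (N * K)\<^sup>2"
    using assms by (simp add: power_mult_distrib)
  finally have "(m * n + s * t)\<^sup>2 = (N * K)\<^sup>2 - (t * m - s * n)\<^sup>2" by simp
  then show "((m * n + s * t) / (N * K))\<^sup>2 = 1 - ((t * m - s * n) / (N * K))\<^sup>2"
    using assms(1,2) unfolding power_divide by (simp add: diff_divide_distrib)
qed (use assms in auto)

text \<open>
  Young's inequality for \<open>sqrt (x/a)\<close> and \<open>sqrt (y/b)\<close>, squared.  With \<open>x = |X|\<close>, \<open>y = |Y|\<close>,
  \<open>a = \<parallel>X\<parallel>\<^sub>p\<close> and \<open>b = \<parallel>Y\<parallel>\<^sub>q\<close>, the two pure squares in the expansion of the right-hand square have
  expectations \<open>1/p\<^sup>2\<close> and \<open>1/q\<^sup>2\<close>, and only the cross term depends on the joint law of \<open>X\<close> and \<open>Y\<close>.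
\<close>

lemma Young_half_powers:
  fixes x y a b p q :: real
  assumes "p > 1" "q > 1" "1 / p + 1 / q = 1" "x \<ge> 0" "y \<ge> 0" "a > 0" "b > 0"
  shows "x * y \<le> a * b * (x powr (p / 2) / (p * a powr (p / 2)) +
                          y powr (q / 2) / (q * b powr (q / 2)))\<^sup>2"
proof -
  let ?w = "x powr (p / 2) / (p * a powr (p / 2)) + y powr (q / 2) / (q * b powr (q / 2))"
  have sqrt_powr: "sqrt z powr r = z powr (r / 2)" if "z \<ge> 0" for z r :: real
    using that by (simp add: powr_half_sqrt [symmetric] powr_powr)
  have "sqrt (x / a) * sqrt (y / b) \<le> sqrt (x / a) powr p / p + sqrt (y / b) powr q / q"
    using assms by (intro Youngs_inequality) auto
  also have "\<dots> = ?w"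
    using assms by (simp add: sqrt_powr powr_divide mult.commute del: real_sqrt_divide)
  finally have "(sqrt (x / a) * sqrt (y / b))\<^sup>2 \<le> ?w\<^sup>2"
    using assms by (intro power_mono) auto
  then have "x / a * (y / b) \<le> ?w\<^sup>2"
    using assms by (simp add: power_mult_distrib del: real_sqrt_divide)
  then have "a * b * (x / a * (y / b)) \<le> a * b * ?w\<^sup>2"
    using assms by (intro mult_left_mono) auto
  then show ?thesis using assms by simp
qed

lemma integrable_mult_of_square_integrable:
  fixes f g :: "'a \<Rightarrow> real"
  assumes [measurable]: "f \<in> borel_measurable M" "g \<in> borel_measurable M"
    and "integrable M (\<lambda>x. (f x)\<^sup>2)" "integrable M (\<lambda>x. (g x)\<^sup>2)"
  shows "integrable M (\<lambda>x. f x * g x)"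
proof (rule Bochner_Integration.integrable_bound)
  show "integrable M (\<lambda>x. (f x)\<^sup>2 + (g x)\<^sup>2)" using assms by simp
  have "\<bar>u * v\<bar> \<le> u\<^sup>2 + v\<^sup>2" for u v :: real
    using sum_squares_bound [of "\<bar>u\<bar>" "\<bar>v\<bar>"] abs_ge_zero [of "u * v"]
    unfolding abs_mult power2_abs by linarith
  then show "AE x in M. norm (f x * g x) \<le> norm ((f x)\<^sup>2 + (g x)\<^sup>2)"
    by (auto intro!: AE_I2 order_trans [OF _ abs_ge_self])
qed measurable

text \<open>
  The discriminant argument: integrating \<open>(B f - C g)\<^sup>2\<close> with \<open>B = \<integral>g\<^sup>2\<close> and \<open>C = \<integral>f g\<close> gives
  \<open>B (A B - C\<^sup>2)\<close>, where \<open>A = \<integral>f\<^sup>2\<close>.  Only when \<open>B = 0\<close>, that is when \<open>g\<close> vanishes almost everywhere,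
  does this say nothing.
\<close>

lemma Cauchy_Schwarz_integral:
  fixes f g :: "'a \<Rightarrow> real"
  assumes [measurable]: "f \<in> borel_measurable M" "g \<in> borel_measurable M"
    and f: "integrable M (\<lambda>x. (f x)\<^sup>2)" and g: "integrable M (\<lambda>x. (g x)\<^sup>2)"
  shows "(\<integral>x. f x * g x \<partial>M)\<^sup>2 \<le> (\<integral>x. (f x)\<^sup>2 \<partial>M) * (\<integral>x. (g x)\<^sup>2 \<partial>M)"
proof -
  define A B C where "A = (\<integral>x. (f x)\<^sup>2 \<partial>M)" and "B = (\<integral>x. (g x)\<^sup>2 \<partial>M)" and "C = (\<integral>x. f x * g x \<partial>M)"
  have fg: "integrable M (\<lambda>x. f x * g x)"
    using assms by (rule integrable_mult_of_square_integrable)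
  have "B \<ge> 0" by (simp add: B_def)
  show ?thesis
  proof (cases "B = 0")
    case True
    then have "AE x in M. (g x)\<^sup>2 = 0"
      using integral_nonneg_eq_0_iff_AE [OF g] by (simp add: B_def)
    then have "C = 0" unfolding C_def by (intro integral_eq_zero_AE) auto
    then show ?thesis using True by (simp add: B_def C_def)
  next
    case False
    have "0 \<le> (\<integral>x. (B * f x - C * g x)\<^sup>2 \<partial>M)" by simp
    also have "\<dots> = (\<integral>x. B\<^sup>2 * (f x)\<^sup>2 - 2 * B * C * (f x * g x) + C\<^sup>2 * (g x)\<^sup>2 \<partial>M)"
      by (intro Bochner_Integration.integral_cong) (auto simp: power2_eq_square algebra_simps)
    also have "\<dots> = B\<^sup>2 * A - 2 * B * C * C + C\<^sup>2 * B"
      using f g fg by (simp add: A_def B_def C_def)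
    also have "\<dots> = B * (A * B - C\<^sup>2)"
      by (simp add: power2_eq_square algebra_simps)
    finally have "C\<^sup>2 \<le> A * B"
      using False \<open>B \<ge> 0\<close> by (simp add: zero_le_mult_iff)
    then show ?thesis by (simp add: A_def B_def C_def)
  qed
qed

lemma (in prob_space) std_dev_eq_sqrt_variance:
  fixes f :: "'a \<Rightarrow> real"
  assumes "integrable M f" "integrable M (\<lambda>x. (f x)\<^sup>2)"
  shows "std_dev M f = sqrt (variance f)"
  using assms by (simp add: std_dev_def variance_eq)

lemma (in prob_space) covariance_le_std_dev_mult:
  fixes f g :: "'a \<Rightarrow> real"
  assumes [measurable]: "f \<in> borel_measurable M" "g \<in> borel_measurable M"
    and f2: "integrable M (\<lambda>x. (f x)\<^sup>2)" and g2: "integrable M (\<lambda>x. (g x)\<^sup>2)"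
  shows "expectation (\<lambda>x. f x * g x) - expectation f * expectation g \<le> std_dev M f * std_dev M g"
proof -
  define f' g' where "f' x = f x - expectation f" and "g' x = g x - expectation g" for x
  have f: "integrable M f" and g: "integrable M g"
    using f2 g2 by (auto intro: square_integrable_imp_integrable)
  have fg: "integrable M (\<lambda>x. f x * g x)"
    using assms by (rule integrable_mult_of_square_integrable)
  have [measurable]: "f' \<in> borel_measurable M" "g' \<in> borel_measurable M"
    by (simp_all add: f'_def [abs_def] g'_def [abs_def])
  have "integrable M (\<lambda>x. (f' x)\<^sup>2)" "integrable M (\<lambda>x. (g' x)\<^sup>2)"
    using f g f2 g2 by (simp_all add: f'_def g'_def power2_diff)
  then have "(expectation (\<lambda>x. f' x * g' x))\<^sup>2 \<le> variance f * variance g"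
    using Cauchy_Schwarz_integral [of f' M g'] by (simp add: f'_def g'_def)
  then have "\<bar>expectation (\<lambda>x. f' x * g' x)\<bar> \<le> std_dev M f * std_dev M g"
    using f g f2 g2 real_sqrt_le_mono [of "(expectation (\<lambda>x. f' x * g' x))\<^sup>2"]
    by (simp add: std_dev_eq_sqrt_variance real_sqrt_mult [symmetric])
  moreover have "expectation (\<lambda>x. f' x * g' x) =
      expectation (\<lambda>x. f x * g x - expectation g * f x - expectation f * g x
                        + expectation f * expectation g)"
    by (simp add: f'_def g'_def algebra_simps)
  moreover have "\<dots> = expectation (\<lambda>x. f x * g x) - expectation f * expectation g"
    using f g fg by (simp add: prob_space)
  ultimately show ?thesis by linarith
qed

text \<open>
  The passage from \<open>L\<^sup>r\<close> to \<open>L\<^sup>2\<close>, where variances and Cauchy--Schwarz are available.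
\<close>

lemma half_power_of_Lp:
  assumes "r > 0" "Z \<in> Lp_space M r"
  shows "(\<lambda>x. \<bar>Z x\<bar> powr (r / 2)) \<in> borel_measurable M"
    and "integrable M (\<lambda>x. (\<bar>Z x\<bar> powr (r / 2))\<^sup>2)"
    and "(\<integral>x. (\<bar>Z x\<bar> powr (r / 2))\<^sup>2 \<partial>M) = (Lp_norm M r Z powr (r / 2))\<^sup>2"
proof -
  have [measurable]: "Z \<in> borel_measurable M" and Z: "integrable M (\<lambda>x. \<bar>Z x\<bar> powr r)"
    using assms by (auto simp: Lp_space_def)
  have square_half: "(c powr (r / 2))\<^sup>2 = c powr r" for c :: real
    by (simp add: power2_eq_square powr_add [symmetric])
  show "(\<lambda>x. \<bar>Z x\<bar> powr (r / 2)) \<in> borel_measurable M" by measurable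
  show "integrable M (\<lambda>x. (\<bar>Z x\<bar> powr (r / 2))\<^sup>2)"
    using Z by (simp add: square_half)
  show "(\<integral>x. (\<bar>Z x\<bar> powr (r / 2))\<^sup>2 \<partial>M) = (Lp_norm M r Z powr (r / 2))\<^sup>2"
    using assms(1) by (simp add: square_half Lp_norm_def powr_powr powr_half_sqrt)
qed

lemma square_integrable_imp_Lp_2:
  fixes f :: "'a \<Rightarrow> real"
  assumes "f \<in> borel_measurable M" "integrable M (\<lambda>x. (f x)\<^sup>2)"
  shows "f \<in> Lp_space M 2"
  using assms by (simp add: Lp_space_def powr_numeral)

theorem proposition3:
  fixes Q :: "'a measure" and X Y U V :: "'a \<Rightarrow> real" and p q :: real
  assumes "prob_space Q"
    and "p > 0" and "q > 0" and "1 / p + 1 / q = 1"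
    and "X \<in> Lp_space Q p" and "Y \<in> Lp_space Q q"
    and "Lp_norm Q p X \<noteq> 0" and "Lp_norm Q q Y \<noteq> 0"
    and "U = (\<lambda>x. \<bar>X x\<bar> powr (p / 2))"
    and "V = (\<lambda>x. \<bar>Y x\<bar> powr (q / 2))"
  shows "U \<in> Lp_space Q 2 \<and> V \<in> Lp_space Q 2 \<and> integrable Q (\<lambda>x. \<bar>X x * Y x\<bar>) \<and>
    (let B = Lp_norm Q p X * Lp_norm Q q Y *
           (1 / p\<^sup>2 + 1 / q\<^sup>2 + 2 / (p * q) *
             sqrt (1 -
               ((std_dev Q V * (\<integral>x. \<bar>X x\<bar> powr (p / 2) \<partial>Q)
                  - std_dev Q U * (\<integral>x. \<bar>Y x\<bar> powr (q / 2) \<partial>Q))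
                / (Lp_norm Q p X powr (p / 2) * Lp_norm Q q Y powr (q / 2)))\<^sup>2))
     in (\<integral>x. \<bar>X x * Y x\<bar> \<partial>Q) \<le> B \<and> B \<le> Lp_norm Q p X * Lp_norm Q q Y)"
proof -
  interpret prob_space Q by fact
  note pq = \<open>p > 0\<close> \<open>q > 0\<close> \<open>1 / p + 1 / q = 1\<close>
  define a b where "a = Lp_norm Q p X" and "b = Lp_norm Q q Y"
  define N K where "N = a powr (p / 2)" and "K = b powr (q / 2)"
  have ab: "a > 0" "b > 0"
    using assms(7,8) by (auto simp: a_def b_def Lp_norm_def)
  then have NK: "N > 0" "K > 0" by (simp_all add: N_def K_def)
  have "1 / p > 0" "1 / q > 0" using pq by simp_all
  then have "1 / p < 1" "1 / q < 1" using pq(3) by linarith+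
  then have conj_gt_1: "p > 1" "q > 1" using pq by simp_all
  have [measurable]: "X \<in> borel_measurable Q" "Y \<in> borel_measurable Q"
    using assms(5,6) by (auto simp: Lp_space_def)

  have UV_meas [measurable]: "U \<in> borel_measurable Q" "V \<in> borel_measurable Q"
    and U2: "integrable Q (\<lambda>x. (U x)\<^sup>2)" and V2: "integrable Q (\<lambda>x. (V x)\<^sup>2)"
    and EU2: "expectation (\<lambda>x. (U x)\<^sup>2) = N\<^sup>2" and EV2: "expectation (\<lambda>x. (V x)\<^sup>2) = K\<^sup>2"
    unfolding assms(9,10) N_def K_def a_def b_def
    using half_power_of_Lp [OF \<open>p > 0\<close> assms(5)] half_power_of_Lp [OF \<open>q > 0\<close> assms(6)]
    by blast+
  have U: "integrable Q U" and V: "integrable Q V"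
    using U2 V2 by (auto intro: square_integrable_imp_integrable)
  have UV: "integrable Q (\<lambda>x. U x * V x)"
    using UV_meas U2 V2 by (rule integrable_mult_of_square_integrable)

  \<comment> \<open>The plane vectors \<open>(m, s)\<close> and \<open>(n, t)\<close> have lengths \<open>N\<close> and \<open>K\<close>.\<close>
  define m n s t where "m = expectation U" and "n = expectation V"
    and "s = std_dev Q U" and "t = std_dev Q V"
  have nonneg: "m \<ge> 0" "n \<ge> 0" "s \<ge> 0" "t \<ge> 0"
    using U V U2 V2 by (simp_all add: m_def n_def s_def t_def assms(9,10)
        std_dev_eq_sqrt_variance)
  have second_moment: "(expectation f)\<^sup>2 + (std_dev Q f)\<^sup>2 = expectation (\<lambda>x. (f x)\<^sup>2)"
    if "integrable Q f" "integrable Q (\<lambda>x. (f x)\<^sup>2)" for f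
  proof -
    have "(std_dev Q f)\<^sup>2 = variance f"
      using that by (simp add: std_dev_eq_sqrt_variance)
    then show ?thesis using that by (simp add: variance_eq)
  qed
  define cosine where "cosine = sqrt (1 - ((t * m - s * n) / (N * K))\<^sup>2)"
  have "cosine = (m * n + s * t) / (N * K)"
    unfolding cosine_def
    using NK second_moment [OF U U2] second_moment [OF V V2] nonneg
    by (intro sqrt_one_minus_det_sq_eq_inner) (simp_all add: EU2 EV2 m_def n_def s_def t_def)
  moreover have "expectation (\<lambda>x. U x * V x) \<le> m * n + s * t"
    using covariance_le_std_dev_mult [OF UV_meas U2 V2] by (simp add: m_def n_def s_def t_def)
  ultimately have correlation: "expectation (\<lambda>x. U x * V x) / (N * K) \<le> cosine"
    using NK by (simp add: divide_right_mono)

  \<comment> \<open>The expanded right-hand side of the squared Young inequality, as a random variable.\<close>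
  define W where "W x = a * b * (1 / (p\<^sup>2 * N\<^sup>2) * (U x)\<^sup>2 + 1 / (q\<^sup>2 * K\<^sup>2) * (V x)\<^sup>2
                                + 2 / (p * q * (N * K)) * (U x * V x))" for x
  have W: "integrable Q W"
    using U2 V2 UV by (simp add: W_def [abs_def])
  have XY_le_W: "\<bar>X x * Y x\<bar> \<le> W x" for x
  proof -
    have "\<bar>X x * Y x\<bar> \<le> a * b * (U x / (p * N) + V x / (q * K))\<^sup>2"
      using Young_half_powers [OF conj_gt_1 pq(3), of "\<bar>X x\<bar>" "\<bar>Y x\<bar>" a b] ab
      by (simp add: abs_mult assms(9,10) N_def K_def)
    also have "\<dots> = W x"
      by (simp add: W_def power2_sum power_mult_distrib power_divide mult_ac)
    finally show ?thesis .
  qed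
  have XY: "integrable Q (\<lambda>x. \<bar>X x * Y x\<bar>)"
    by (rule Bochner_Integration.integrable_bound [OF W])
      (auto intro!: AE_I2 order_trans [OF XY_le_W])

  have "expectation (\<lambda>x. \<bar>X x * Y x\<bar>) \<le> expectation W"
    using XY W XY_le_W by (intro integral_mono)
  also have "\<dots> = a * b * (1 / p\<^sup>2 + 1 / q\<^sup>2 + 2 / (p * q) * (expectation (\<lambda>x. U x * V x) / (N * K)))"
    using U2 V2 UV NK by (simp add: W_def [abs_def] EU2 EV2)
  also have "\<dots> \<le> a * b * (1 / p\<^sup>2 + 1 / q\<^sup>2 + 2 / (p * q) * cosine)"
    using ab pq correlation by (intro mult_left_mono add_left_mono) auto
  finally have first: "expectation (\<lambda>x. \<bar>X x * Y x\<bar>) \<le> a * b * (1 / p\<^sup>2 + 1 / q\<^sup>2 + 2 / (p * q) * cosine)" .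

  have "1 / p\<^sup>2 + 1 / q\<^sup>2 + 2 / (p * q) * cosine \<le> 1 / p\<^sup>2 + 1 / q\<^sup>2 + 2 / (p * q) * 1"
    using pq unfolding cosine_def by (intro add_left_mono mult_left_mono) auto
  also have "\<dots> = (1 / p + 1 / q)\<^sup>2"
    by (simp add: power2_sum power_divide)
  finally have "1 / p\<^sup>2 + 1 / q\<^sup>2 + 2 / (p * q) * cosine \<le> 1"
    using pq by simp
  then have "a * b * (1 / p\<^sup>2 + 1 / q\<^sup>2 + 2 / (p * q) * cosine) \<le> a * b"
    using ab by (intro mult_left_le) auto
  with first XY square_integrable_imp_Lp_2 [OF UV_meas(1) U2]
    square_integrable_imp_Lp_2 [OF UV_meas(2) V2]
  show ?thesis
    unfolding Let_def cosine_def m_def n_def s_def t_def N_def K_def a_def b_def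
      assms(9,10) [symmetric]
    by blast
qed

end
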